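(* Let $\omega=(\omega_1,\dots,\omega_N)$ be weights with $\omega_j\ge 0$, let $\nu_\omega$ be a sparse function, let $s$ be a positive integer, and let $\Phi\in\mathbb{C}^{m\times N}$. Then the following are equivalent: (i) every vector $\hat{x}\in\mathbb{C}^N$ whose support $S$ satisfies $\nu_\omega(S)\le s$ is the unique solution of $$\min_{z\in\mathbb{C}^N}\|z\|_{\omega,1}\quad\text{subject to}\quad \Phi z=\Phi\hat{x};$$ (ii) $\Phi$ satisfies the generalized weighted null space property ($\omega$-NSP) of order $s$ (with respect to the same sparse function $\nu_\omega$).
   Context: $[N]=\{1,\dots,N\}$. For $x\in\mathbb{C}^N$, $\|x\|_{\omega,1}=\sum_{j=1}^N\omega_j|x_j|$. For $S\subset[N]$, $S^c=[N]\setminus S$ and $x_S$ is the vector that equals $x$ on $S$ and is zero elsewhere. A sparse function $\nu_\omega$ assigns to every $S\subset[N]$ a real number $\nu_\omega(S)\ge 0$ such that $\nu_\omega(S_1\cup S_2)=\nu_\omega(S_1)+\nu_\omega(S_2)$ whenever $S_1\cap S_2=\emptyset$. Standing assumption: $s\ge 2\max_{i\in[N]}\nu_\omega(\{i\})$. $\omega$-NSP: a matrix $A\in\mathbb{C}^{m\times N}$ satisfies the $\omega$-NSP of order $s$ if $\|v_S\|_{\omega,1}<\|v_{S^c}\|_{\omega,1}$ for all $v\in\ker(A)\setminus\{0\}$ and all $S\subset[N]$ with $\nu_\omega(S)\le s$. *)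

theory Defs
  imports "HOL-Analysis.Analysis"
begin

text \<open>The index set \<open>[N]\<close> is the finite type \<open>'n\<close>, so \<open>N = CARD('n)\<close>.
  Weights may vanish, so \<open>weighted_l1\<close> is in general only a seminorm.\<close>

definition weighted_l1 :: "real ^ 'n \<Rightarrow> complex ^ 'n \<Rightarrow> real" where
  "weighted_l1 w x = (\<Sum>j\<in>UNIV. w $ j * cmod (x $ j))"

definition restrict_vec :: "complex ^ 'n \<Rightarrow> 'n set \<Rightarrow> complex ^ 'n" where
  "restrict_vec x S = (\<chi> j. if j \<in> S then x $ j else 0)"

definition vec_support :: "complex ^ 'n \<Rightarrow> 'n set" where
  "vec_support x = {j. x $ j \<noteq> 0}"

definition sparse_function :: "('n::finite set \<Rightarrow> real) \<Rightarrow> bool" where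
  "sparse_function \<nu> \<longleftrightarrow>
     (\<forall>S. 0 \<le> \<nu> S) \<and>
     (\<forall>S1 S2. S1 \<inter> S2 = {} \<longrightarrow> \<nu> (S1 \<union> S2) = \<nu> S1 + \<nu> S2)"

definition weighted_NSP ::
    "real ^ 'n \<Rightarrow> ('n set \<Rightarrow> real) \<Rightarrow> real \<Rightarrow> complex ^ 'n ^ 'm \<Rightarrow> bool" where
  "weighted_NSP w \<nu> s A \<longleftrightarrow>
     (\<forall>v \<in> {v. A *v v = 0} - {0}. \<forall>S. \<nu> S \<le> s \<longrightarrow>
        weighted_l1 w (restrict_vec v S) < weighted_l1 w (restrict_vec v (- S)))"

definition l1_solutions ::
    "real ^ 'n \<Rightarrow> complex ^ 'n ^ 'm \<Rightarrow> complex ^ 'm \<Rightarrow> (complex ^ 'n) set" where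
  "l1_solutions w A y = {x. is_arg_min (weighted_l1 w) (\<lambda>z. A *v z = y) x}"

end

theory Submission
  imports Defs
begin

text \<open>
  Two vectors have the same image under \<open>\<Phi>\<close> iff they differ by a kernel element, so both
  conditions compare weighted norms of the pieces of kernel vectors. If sparse vectors are
  recovered uniquely, then, for \<open>v\<close> in the kernel, \<open>v\<^sub>S\<close> and \<open>- v\<^bsub>-S\<^esub>\<close> have the same image, they
  differ when \<open>v \<noteq> 0\<close>, and \<open>v\<^sub>S\<close> is sparse; so \<open>v\<^sub>S\<close> has strictly smaller norm.
  Conversely, let \<open>x\<close> be supported on a sparse \<open>S\<close>, let \<open>z \<noteq> x\<close> have the same image, and put
  \<open>v = x - z\<close>. Since \<open>v\<close> agrees with \<open>- z\<close> off \<open>S\<close>, splitting \<open>z\<close> along \<open>S\<close> gives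
  \<open>\<parallel>x\<parallel> \<le> \<parallel>v\<^sub>S\<parallel> + \<parallel>z\<^sub>S\<parallel> < \<parallel>v\<^bsub>-S\<^esub>\<parallel> + \<parallel>z\<^sub>S\<parallel> = \<parallel>z\<parallel>\<close>.
  Only strict inequalities are used to separate vectors, so it does no harm that
  vanishing weights make the norm a seminorm.
\<close>

lemma weighted_l1_split:
  "weighted_l1 w x = weighted_l1 w (restrict_vec x S) + weighted_l1 w (restrict_vec x (- S))"
  unfolding weighted_l1_def restrict_vec_def sum.distrib[symmetric]
  by (rule sum.cong) auto

lemma weighted_l1_triangle:
  assumes "\<And>j. 0 \<le> w $ j"
  shows "weighted_l1 w (x + y) \<le> weighted_l1 w x + weighted_l1 w y"
  unfolding weighted_l1_def sum.distrib[symmetric] distrib_left[symmetric]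
  by (intro sum_mono mult_left_mono assms) (simp add: norm_triangle_ineq)

lemma weighted_l1_minus: "weighted_l1 w (- x) = weighted_l1 w x"
  by (simp add: weighted_l1_def)

lemma restrict_vec_plus_compl: "restrict_vec x S + restrict_vec x (- S) = x"
  by (simp add: restrict_vec_def vec_eq_iff)

lemma sparse_function_mono:
  assumes "sparse_function \<nu>" "S \<subseteq> T"
  shows "\<nu> S \<le> \<nu> T"
proof -
  have "\<nu> (S \<union> (T - S)) = \<nu> S + \<nu> (T - S)"
    using assms(1) unfolding sparse_function_def by blast
  moreover have "0 \<le> \<nu> (T - S)"
    using assms(1) unfolding sparse_function_def by blast
  moreover have "S \<union> (T - S) = T"
    using assms(2) by blast
  ultimately show ?thesis by simp
qed

lemma l1_solutions_eq_singleton_iff: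
  "l1_solutions w A (A *v x) = {x} \<longleftrightarrow>
     (\<forall>z. A *v z = A *v x \<longrightarrow> z \<noteq> x \<longrightarrow> weighted_l1 w x < weighted_l1 w z)"
  (is "?sol = {x} \<longleftrightarrow> ?strict")
proof
  assume sol: "?sol = {x}"
  show ?strict
  proof (intro allI impI, rule ccontr)
    fix z assume z: "A *v z = A *v x" "z \<noteq> x" "\<not> weighted_l1 w x < weighted_l1 w z"
    \<comment> \<open>Then \<open>z\<close> is a second minimizer.\<close>
    have "x \<in> ?sol" using sol by simp
    then have "z \<in> ?sol"
      using z(1,3) unfolding l1_solutions_def is_arg_min_def by fastforce
    with sol z(2) show False by simp
  qed
next
  assume strict: ?strict
  have "x \<in> ?sol"
    using strict unfolding l1_solutions_def is_arg_min_def by force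
  moreover have "z = x" if "z \<in> ?sol" for z
    using that strict unfolding l1_solutions_def is_arg_min_def by auto
  ultimately show "?sol = {x}" by blast
qed

lemma weighted_NSP_imp_unique_solution:
  assumes weights: "\<And>j. 0 \<le> w $ j"
    and nsp: "weighted_NSP w \<nu> s A"
    and x: "\<nu> (vec_support x) \<le> s"
  shows "l1_solutions w A (A *v x) = {x}"
  unfolding l1_solutions_eq_singleton_iff
proof (intro allI impI)
  fix z assume z: "A *v z = A *v x" "z \<noteq> x"
  define S where "S = vec_support x"
  define v where "v = x - z"
  have "A *v v = 0" "v \<noteq> 0"
    using z by (auto simp: v_def matrix_vector_mult_diff_distrib)
  then have less: "weighted_l1 w (restrict_vec v S) < weighted_l1 w (restrict_vec v (- S))"
    using nsp x unfolding weighted_NSP_def S_def by blast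
  have "x = restrict_vec v S + restrict_vec z S"
    by (auto simp: vec_eq_iff restrict_vec_def v_def S_def vec_support_def)
  then have "weighted_l1 w x \<le> weighted_l1 w (restrict_vec v S) + weighted_l1 w (restrict_vec z S)"
    using weighted_l1_triangle[OF weights, of "restrict_vec v S" "restrict_vec z S"] by simp
  moreover have "restrict_vec v (- S) = - restrict_vec z (- S)"
    by (auto simp: vec_eq_iff restrict_vec_def v_def S_def vec_support_def)
  then have "weighted_l1 w (restrict_vec v (- S)) = weighted_l1 w (restrict_vec z (- S))"
    by (simp add: weighted_l1_minus)
  ultimately show "weighted_l1 w x < weighted_l1 w z"
    using less weighted_l1_split[of w z S] by linarith
qed

lemma unique_solutions_imp_weighted_NSP:
  assumes sparse: "sparse_function \<nu>"
    and unique: "\<And>x. \<nu> (vec_support x) \<le> s \<Longrightarrow> l1_solutions w A (A *v x) = {x}"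
  shows "weighted_NSP w \<nu> s A"
  unfolding weighted_NSP_def
proof (intro ballI allI impI)
  fix v S assume "v \<in> {v. A *v v = 0} - {0}" and S: "\<nu> S \<le> s"
  then have v: "A *v v = 0" "v \<noteq> 0" by auto
  let ?x = "restrict_vec v S" and ?z = "- restrict_vec v (- S)"
  have diff: "?x - ?z = v"
    by (simp add: restrict_vec_plus_compl)
  have "A *v ?x - A *v ?z = 0"
    using v(1) diff by (metis matrix_vector_mult_diff_distrib)
  then have "A *v ?z = A *v ?x" by simp
  moreover have "?z \<noteq> ?x"
  proof
    assume "?z = ?x"
    then have "?x - ?z = 0" by (rule right_minus_eq[THEN iffD2, OF sym])
    then show False unfolding diff using v(2) by contradiction
  qed
  moreover have "vec_support ?x \<subseteq> S"
    by (auto simp: vec_support_def restrict_vec_def)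
  then have "\<nu> (vec_support ?x) \<le> s"
    using S by (rule order_trans[OF sparse_function_mono[OF sparse]])
  then have "l1_solutions w A (A *v ?x) = {?x}" by (rule unique)
  ultimately have "weighted_l1 w ?x < weighted_l1 w ?z"
    unfolding l1_solutions_eq_singleton_iff by blast
  then show "weighted_l1 w ?x < weighted_l1 w (restrict_vec v (- S))"
    by (simp add: weighted_l1_minus)
qed

theorem theorem2p3:
  fixes \<omega> :: "real ^ 'n" and \<nu> :: "'n set \<Rightarrow> real" and s :: nat
    and \<Phi> :: "complex ^ 'n ^ 'm"
  assumes weights: "\<And>j. 0 \<le> \<omega> $ j"
    and sparse: "sparse_function \<nu>"
    and s_pos: "0 < s"
    and s_ge: "2 * Max (range (\<lambda>i. \<nu> {i})) \<le> real s"
  shows "(\<forall>xhat. \<nu> (vec_support xhat) \<le> real s \<longrightarrow> l1_solutions \<omega> \<Phi> (\<Phi> *v xhat) = {xhat})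
     \<longleftrightarrow> weighted_NSP \<omega> \<nu> (real s) \<Phi>"
proof
  assume "\<forall>xhat. \<nu> (vec_support xhat) \<le> real s \<longrightarrow> l1_solutions \<omega> \<Phi> (\<Phi> *v xhat) = {xhat}"
  then show "weighted_NSP \<omega> \<nu> (real s) \<Phi>"
    by (intro unique_solutions_imp_weighted_NSP[OF sparse]) simp
next
  assume "weighted_NSP \<omega> \<nu> (real s) \<Phi>"
  then show "\<forall>xhat. \<nu> (vec_support xhat) \<le> real s \<longrightarrow> l1_solutions \<omega> \<Phi> (\<Phi> *v xhat) = {xhat}"
    using weighted_NSP_imp_unique_solution[OF weights] by blast
qed

end
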